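(* Let $n_1,n_2$ be nonnegative integers and $z_1,z_2\in\mathbb{C}$. Then \[ \zeta_2(-n_1,-n_2;z_1+1,z_2)=\zeta_2(-n_1,-n_2;z_1,z_2)+\frac{(-1)^{n_1+n_2}}{n_2+1}\,z_1^{n_1}\,B_{n_2+1}(z_1+z_2). \]
   Context: Bernoulli numbers $B_m$ are defined by $\frac{t}{e^t-1}=\sum_{m\ge0}B_m\frac{t^m}{m!}$. Bernoulli polynomials are $B_m(z)=\sum_{j=0}^m\binom{m}{j}B_jz^{m-j}$. The depth-2 shifted multiple zeta value at negative integers (the paper's symbolic form of Sadaoui's analytic continuation, $(-1)^{n_1+n_2}\mathcal{C}_1^{n_1+1}(z_1)\mathcal{C}_{1,2}^{n_2+1}(z_1,z_2)$) is explicitly \[ \zeta_2(-n_1,-n_2;z_1,z_2)=\frac{(-1)^{n_1+n_2}}{n_2+1}\sum_{k=0}^{n_2+1}\binom{n_2+1}{k}\frac{B_{n_1+1+k}(z_1)}{n_1+1+k}\,B_{n_2+1-k}(z_2). \] *)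

theory Defs
  imports Complex_Main "HOL-Computational_Algebra.Formal_Power_Series"
begin

text \<open>
  The quotient below is the division of formal power series, which cancels the common factor
  \<open>X\<close> of numerator and denominator; the lemma \<open>bernoulli_gen_fun\<close> confirms that it is the exact
  quotient.
\<close>

definition bernoulli :: "nat \<Rightarrow> complex" where
  "bernoulli m = fact m * fps_nth (fps_X / (fps_exp 1 - 1)) m"

definition bernpoly :: "nat \<Rightarrow> complex \<Rightarrow> complex" where
  "bernpoly m z = (\<Sum>j\<le>m. of_nat (m choose j) * bernoulli j * z ^ (m - j))"

text \<open>
  The arguments \<open>n\<^sub>1, n\<^sub>2\<close> stand for the negated exponents: \<open>zeta2_neg n\<^sub>1 n\<^sub>2 z\<^sub>1 z\<^sub>2\<close> is
  \<open>\<zeta>\<^sub>2(-n\<^sub>1, -n\<^sub>2; z\<^sub>1, z\<^sub>2)\<close>.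
\<close>

definition zeta2_neg :: "nat \<Rightarrow> nat \<Rightarrow> complex \<Rightarrow> complex \<Rightarrow> complex" where
  "zeta2_neg n1 n2 z1 z2 =
     (-1) ^ (n1 + n2) / of_nat (n2 + 1) *
     (\<Sum>k = 0..n2 + 1. of_nat ((n2 + 1) choose k) *
        (bernpoly (n1 + 1 + k) z1 / of_nat (n1 + 1 + k)) * bernpoly (n2 + 1 - k) z2)"

lemma bernoulli_gen_fun:
  "Abs_fps (\<lambda>m. bernoulli m / fact m) * (fps_exp 1 - 1) = fps_X"
proof -
  let ?g = "fps_exp 1 - 1 :: complex fps"
  have nz: "fps_nth ?g 1 \<noteq> 0"
    by simp
  hence "?g \<noteq> 0"
    by (metis fps_zero_nth)
  moreover have "subdegree ?g \<le> 1"
    using nz by (rule subdegree_leI)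
  ultimately have "?g dvd fps_X"
    by (subst fps_dvd_iff) auto
  moreover have "Abs_fps (\<lambda>m. bernoulli m / fact m) = fps_X / ?g"
    by (rule fps_ext) (simp add: bernoulli_def)
  ultimately show ?thesis
    by simp
qed

end

theory Submission
  imports Defs
begin

text \<open>
  The generating function of the Bernoulli polynomials is \<open>t e\<^sup>z\<^sup>t / (e\<^sup>t - 1)\<close>. It yields
  \<open>B\<^sub>m(z + 1) - B\<^sub>m(z) = m z\<^sup>m\<^sup>-\<^sup>1\<close>, so the shift of \<open>z\<^sub>1\<close> increases each quotient
  \<open>B\<^sub>m(z\<^sub>1) / m\<close> in the defining sum by \<open>z\<^sub>1\<^sup>m\<^sup>-\<^sup>1\<close>. The increments sum to the addition formula
  for \<open>B(z\<^sub>1 + z\<^sub>2)\<close>, which expresses that \<open>e\<^sup>z\<^sup>t\<close> is multiplicative in \<open>z\<close>.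
\<close>

text \<open>The binomial sum defining \<open>bernpoly\<close> is the Cauchy product of two
  exponential generating functions.\<close>

lemma bernpoly_gen_fun:
  "Abs_fps (\<lambda>m. bernpoly m z / fact m) = Abs_fps (\<lambda>m. bernoulli m / fact m) * fps_exp z"
  by (rule fps_ext)
     (auto simp: fps_mult_nth bernpoly_def binomial_fact sum_divide_distrib atLeast0AtMost
           intro!: sum.cong)

lemma bernpoly_Suc_shift:
  "bernpoly (Suc n) (z + 1) = bernpoly (Suc n) z + of_nat (Suc n) * z ^ n"
proof -
  let ?B = "Abs_fps (\<lambda>m. bernoulli m / fact m)"
  \<comment> \<open>Splitting \<open>e^t\<close> as \<open>1 + (e^t - 1)\<close> isolates the factor
    that cancels the denominator of \<open>?B\<close>.\<close>
  have "?B * fps_exp (z + 1) = ?B * fps_exp z + ?B * (fps_exp 1 - 1) * fps_exp z"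
    by (simp add: fps_exp_add_mult algebra_simps)
  also have "\<dots> = ?B * fps_exp z + fps_X * fps_exp z"
    by (simp only: bernoulli_gen_fun)
  finally have "Abs_fps (\<lambda>m. bernpoly m (z + 1) / fact m) =
      Abs_fps (\<lambda>m. bernpoly m z / fact m) + fps_X * fps_exp z"
    by (simp only: bernpoly_gen_fun)
  from arg_cong[OF this, of "\<lambda>f. fps_nth f (Suc n)"]
  have "bernpoly (Suc n) (z + 1) / fact (Suc n) = bernpoly (Suc n) z / fact (Suc n) + z ^ n / fact n"
    by simp
  also have "z ^ n / fact n = of_nat (Suc n) * z ^ n / fact (Suc n)"
    by (simp add: field_simps del: of_nat_Suc)
  finally show ?thesis
    by (simp add: add_divide_distrib[symmetric] del: of_nat_Suc fact_Suc)
qed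

lemma bernpoly_add:
  "bernpoly n (x + y) = (\<Sum>k\<le>n. of_nat (n choose k) * x ^ k * bernpoly (n - k) y)"
proof -
  have "Abs_fps (\<lambda>m. bernpoly m (x + y) / fact m) =
      fps_exp x * Abs_fps (\<lambda>m. bernpoly m y / fact m)"
    by (simp add: bernpoly_gen_fun fps_exp_add_mult mult_ac)
  from arg_cong[OF this, of "\<lambda>f. fps_nth f n"]
  have "bernpoly n (x + y) / fact n =
      (\<Sum>k\<le>n. x ^ k / fact k * (bernpoly (n - k) y / fact (n - k)))"
    by (simp add: fps_mult_nth atLeast0AtMost)
  hence "bernpoly n (x + y) =
      fact n * (\<Sum>k\<le>n. x ^ k / fact k * (bernpoly (n - k) y / fact (n - k)))"
    by (simp add: field_simps)
  also have "\<dots> = (\<Sum>k\<le>n. of_nat (n choose k) * x ^ k * bernpoly (n - k) y)"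
    by (auto simp: sum_distrib_left binomial_fact intro!: sum.cong)
  finally show ?thesis .
qed

theorem theorem5:
  fixes n1 n2 :: nat and z1 z2 :: complex
  shows "zeta2_neg n1 n2 (z1 + 1) z2 =
           zeta2_neg n1 n2 z1 z2
           + (-1) ^ (n1 + n2) / of_nat (n2 + 1) * z1 ^ n1 * bernpoly (n2 + 1) (z1 + z2)"
proof -
  \<comment> \<open>The index \<open>n1 + 1 + k\<close> is positive, so it cancels; splitting the
    power lets \<open>z1 ^ n1\<close> leave the sum over \<open>k\<close>.\<close>
  have shift: "bernpoly (n1 + 1 + k) (z1 + 1) / of_nat (n1 + 1 + k) =
      bernpoly (n1 + 1 + k) z1 / of_nat (n1 + 1 + k) + z1 ^ n1 * z1 ^ k" for k
    using bernpoly_Suc_shift[of "n1 + k" z1]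
    by (simp add: add_divide_distrib power_add del: of_nat_Suc of_nat_add)
  have "(\<Sum>k = 0..n2 + 1. of_nat ((n2 + 1) choose k) *
        (bernpoly (n1 + 1 + k) (z1 + 1) / of_nat (n1 + 1 + k)) * bernpoly (n2 + 1 - k) z2) =
      (\<Sum>k = 0..n2 + 1. of_nat ((n2 + 1) choose k) *
        (bernpoly (n1 + 1 + k) z1 / of_nat (n1 + 1 + k)) * bernpoly (n2 + 1 - k) z2) +
      z1 ^ n1 * bernpoly (n2 + 1) (z1 + z2)"
    \<comment> \<open>The instantiation keeps the addition formula from expanding at
      \<open>z1 + 1\<close>.\<close>
    unfolding shift bernpoly_add[of _ z1 z2] sum_distrib_left atLeast0AtMost sum.distrib[symmetric]
    by (rule sum.cong[OF refl]) (simp only: ring_distribs mult_ac)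
  thus ?thesis
    unfolding zeta2_neg_def by (simp only: ring_distribs mult.assoc)
qed

end
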